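(* Let $r\ge 0$ be an integer and let $n=\prod_{i=1}^{r}p_i^{e_i}$, where $p_1,\dots,p_r$ are distinct primes and $e_i\in\mathbb{Z}_{>0}$. Let $D_n$ be the set of positive divisors of $n$ ordered by divisibility. Then in the ruler game on $D_n$, the Grundy value of $y=p_1^{x_1}\cdots p_r^{x_r}\in D_n$ (with $0\le x_i\le e_i$) is \[ g(y)=h(x_1+1)\otimes h(x_2+1)\otimes\cdots\otimes h(x_r+1), \] where $h(x)=2^{v_2(x)}$ and $v_2(x)$ is the exponent of the largest power of $2$ dividing $x$.
   Context: Coin-turning games: let $X$ be a finite poset and $\mathcal{T}$ a family of nonempty subsets of $X$, each having a maximum element. In the game $\mathcal{G}(X,\mathcal{T})$ a position is a subset $H\subseteq X$ (the heads-up coins); a move from $H$ chooses $T\in\mathcal{T}$ with $\max T\in H$ and replaces $H$ by the symmetric difference $H\,\triangle\,T$; a player unable to move loses (normal play). The Grundy value $g(x)$ of $x\in X$ is the Sprague–Grundy value of the position $\{x\}$; equivalently $g(x)=\operatorname{mex}\{\bigoplus_{t\in T\setminus\{x\}}g(t) : T\in\mathcal{T},\ \max T=x\}$. The ruler on $X$ is the game $\mathcal{G}(X,\mathcal{I})$ where $\mathcal{I}$ is the set of all closed intervals $[a,b]=\{t\in X: a\le t\le b\}$ with $a\le b$ in $X$. Here $\oplus$ is nim-sum (bitwise XOR), $\operatorname{mex}(S)$ is the least nonnegative integer not in $S$, and $\otimes$ is Conway's nim-multiplication on nonnegative integers, defined recursively by $a\otimes b=\operatorname{mex}\{(a'\otimes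 b)\oplus(a\otimes b')\oplus(a'\otimes b') : a'<a,\ b'<b\}$. For $r=0$ (so $n=1$) the empty nim-product is interpreted as $1$. *)

theory Defs
  imports "HOL-Computational_Algebra.Primes"
begin

definition mex :: "nat set \<Rightarrow> nat" where
  "mex S = (LEAST k. k \<notin> S)"

abbreviation nim_sum :: "nat \<Rightarrow> nat \<Rightarrow> nat" (infixl "\<oplus>" 65) where
  "a \<oplus> b \<equiv> Bit_Operations.xor a b"

(* The pairs (a', b') range over a' < a and b' < b; the image form lets the
   function package see these bounds. *)
function nim_mult :: "nat \<Rightarrow> nat \<Rightarrow> nat" (infixl "\<otimes>" 70) where
  "a \<otimes> b = mex ((\<lambda>(a', b'). (a' \<otimes> b) \<oplus> (a \<otimes> b') \<oplus> (a' \<otimes> b')) ` ({..<a} \<times> {..<b}))"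
  by auto
termination
  by (relation "measure (\<lambda>(a, b). a + b)") auto

declare nim_mult.simps [simp del]

primrec nim_prod :: "(nat \<Rightarrow> nat) \<Rightarrow> nat \<Rightarrow> nat" where
  "nim_prod f 0 = 1"
| "nim_prod f (Suc r) = nim_prod f r \<otimes> f (Suc r)"

(* Sprague-Grundy value of a position under normal play, for a game given by the
   options of each position; meaningful when the option relation is well-founded. *)
definition grundy :: "('p \<Rightarrow> 'p set) \<Rightarrow> 'p \<Rightarrow> nat" where
  "grundy opts = wfrec {(q, p). q \<in> opts p} (\<lambda>g p. mex (g ` opts p))"

definition is_maximum :: "('a \<Rightarrow> 'a \<Rightarrow> bool) \<Rightarrow> 'a set \<Rightarrow> 'a \<Rightarrow> bool" where
  "is_maximum le T m \<longleftrightarrow> m \<in> T \<and> (\<forall>t\<in>T. le t m)"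

(* Posets are given by a carrier and an order relation that only matters on the carrier. *)
locale coin_turning_game =
  fixes X :: "'a set" and le :: "'a \<Rightarrow> 'a \<Rightarrow> bool" and \<T> :: "'a set set"
  assumes finite_carrier: "finite X"
    and refl: "reflp_on X le"
    and antisym: "antisymp_on X le"
    and trans: "transp_on X le"
    and turning_sets: "\<And>T. T \<in> \<T> \<Longrightarrow> T \<subseteq> X \<and> (\<exists>m. is_maximum le T m)"

definition coin_moves ::
    "'a set \<Rightarrow> ('a \<Rightarrow> 'a \<Rightarrow> bool) \<Rightarrow> 'a set set \<Rightarrow> 'a set \<Rightarrow> 'a set set" where
  "coin_moves X le \<T> H =
     {sym_diff H T | T m. H \<subseteq> X \<and> T \<in> \<T> \<and> is_maximum le T m \<and> m \<in> H}"

definition coin_grundy ::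
    "'a set \<Rightarrow> ('a \<Rightarrow> 'a \<Rightarrow> bool) \<Rightarrow> 'a set set \<Rightarrow> 'a \<Rightarrow> nat" where
  "coin_grundy X le \<T> x = grundy (coin_moves X le \<T>) {x}"

definition closed_intervals :: "'a set \<Rightarrow> ('a \<Rightarrow> 'a \<Rightarrow> bool) \<Rightarrow> 'a set set" where
  "closed_intervals X le = {{t \<in> X. le a t \<and> le t b} | a b. a \<in> X \<and> b \<in> X \<and> le a b}"

definition ruler_grundy :: "'a set \<Rightarrow> ('a \<Rightarrow> 'a \<Rightarrow> bool) \<Rightarrow> 'a \<Rightarrow> nat" where
  "ruler_grundy X le = coin_grundy X le (closed_intervals X le)"

definition divisors :: "nat \<Rightarrow> nat set" where
  "divisors n = {d. 0 < d \<and> d dvd n}"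

definition h :: "nat \<Rightarrow> nat" where
  "h x = 2 ^ multiplicity 2 x"

lemma one_nim_mult: "1 \<otimes> b = b"
proof (induction b rule: less_induct)
  case (less b)
  have zero: "0 \<otimes> c = 0" for c
    by (subst nim_mult.simps) (simp add: mex_def)
  have "(\<lambda>(a', b'). (a' \<otimes> b) \<oplus> (1 \<otimes> b') \<oplus> (a' \<otimes> b')) ` ({..<1} \<times> {..<b}) = {..<b}"
    using less.IH by (auto simp: zero image_iff)
  then have "1 \<otimes> b = mex {..<b}"
    by (subst nim_mult.simps) (simp only:)
  also have "\<dots> = b"
    unfolding mex_def by (rule Least_equality) auto
  finally show ?case .
qed

lemma grundy_rec:
  assumes "wf {(q, p). q \<in> opts p}"
  shows "grundy opts p = mex (grundy opts ` opts p)"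
proof -
  let ?R = "{(q, p). q \<in> opts p}"
  have "cut (grundy opts) ?R p ` opts p = grundy opts ` opts p"
    by (intro image_cong) (auto simp: cut_apply)
  then show ?thesis
    using wfrec [OF assms, of "\<lambda>g p. mex (g ` opts p)" p] by (simp add: grundy_def)
qed

context coin_turning_game
begin

lemma wf_coin_moves: "wf {(H', H). H' \<in> coin_moves X le \<T> H}"
proof -
  define rank where "rank x = card {y \<in> X. le y x \<and> y \<noteq> x}" for x
  define w where "w x = Suc (card X) ^ rank x" for x
  have rank_less: "rank t < rank m" if "t \<in> X" "m \<in> X" "le t m" "t \<noteq> m" for t m
  proof -
    have "{y \<in> X. le y t \<and> y \<noteq> t} \<subset> {y \<in> X. le y m \<and> y \<noteq> m}"
      using that antisym trans unfolding antisymp_on_def transp_on_def by blast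
    then show ?thesis
      unfolding rank_def using finite_carrier by (intro psubset_card_mono) auto
  qed
  have "sum w (sym_diff H T) < sum w H"
    if H: "H \<subseteq> X" and T: "T \<in> \<T>" and m: "is_maximum le T m" "m \<in> H" for H T m
  proof -
    have TX: "T \<subseteq> X" using turning_sets [OF T] by simp
    have mT: "m \<in> T" and le_m: "\<And>t. t \<in> T \<Longrightarrow> le t m"
      using m(1) by (auto simp: is_maximum_def)
    have fin: "finite H" "finite T"
      using H TX finite_carrier finite_subset by blast+
    have w_le: "Suc (card X) * w t \<le> w m" if "t \<in> T - H" for t
    proof -
      have "rank t < rank m"
        using that H TX m(2) mT le_m by (intro rank_less) auto
      then have "Suc (card X) ^ Suc (rank t) \<le> Suc (card X) ^ rank m"
        by (intro power_increasing) auto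
      then show ?thesis by (simp add: w_def)
    qed
    have "Suc (card X) * sum w (T - H) \<le> (\<Sum>t\<in>T - H. w m)"
      unfolding sum_distrib_left using w_le by (intro sum_mono)
    also have "\<dots> \<le> card X * w m"
      using TX finite_carrier by (simp add: card_mono subset_iff)
    also have "\<dots> < Suc (card X) * w m"
      by (simp add: w_def)
    finally have less: "sum w (T - H) < w m"
      by (simp only: mult_less_cancel1)
    have "sum w (sym_diff H T) = sum w (H - T) + sum w (T - H)"
      using fin by (intro sum.union_disjoint) auto
    also have "\<dots> < sum w (H - T) + w m"
      using less by simp
    also have "\<dots> = sum w (insert m (H - T))"
      using fin mT by simp
    also have "\<dots> \<le> sum w H"
      using fin m(2) by (intro sum_mono2) auto
    finally show ?thesis .
  qed
  then have "{(H', H). H' \<in> coin_moves X le \<T> H} \<subseteq> measure (sum w)"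
    by (auto simp: coin_moves_def)
  then show ?thesis
    by (rule wf_subset [OF wf_measure])
qed

lemmas grundy_coin_moves = grundy_rec [OF wf_coin_moves]

end

lemma ruler_coin_turning_game:
  assumes "finite X" "reflp_on X le" "antisymp_on X le" "transp_on X le"
  shows "coin_turning_game X le (closed_intervals X le)"
proof
  fix T assume "T \<in> closed_intervals X le"
  then obtain a b where ab: "a \<in> X" "b \<in> X" "le a b" "T = {t \<in> X. le a t \<and> le t b}"
    by (auto simp: closed_intervals_def)
  then have "is_maximum le T b"
    using assms(2) by (auto simp: is_maximum_def reflp_on_def)
  then show "T \<subseteq> X \<and> (\<exists>m. is_maximum le T m)"
    using ab by auto
qed (use assms in auto)

lemma divisors_ruler_game:
  assumes "n > 0"
  shows "coin_turning_game (divisors n) (dvd) (closed_intervals (divisors n) (dvd))"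
proof (rule ruler_coin_turning_game)
  show "finite (divisors n)"
    using assms by (auto simp: divisors_def)
  show "reflp_on (divisors n) (dvd)"
    by (auto simp: reflp_on_def)
  show "antisymp_on (divisors n) (dvd)"
    unfolding antisymp_on_def by (blast intro: dvd_antisym)
  show "transp_on (divisors n) (dvd)"
    unfolding transp_on_def by (blast intro: dvd_trans)
qed

end

theory Submission
  imports Defs
begin

text \<open>
  A function on the coins that satisfies the mex recursion computes all Grundy values, because a
  position is then worth the nim-sum over its heads. Hence Grundy values are multiplicative on
  products of coin-turning games (the Tartan theorem): if \<open>a = mex A\<close> and \<open>b = mex B\<close>, then
  \<open>a \<otimes> b\<close> is the mex of \<open>u \<otimes> b \<oplus> a \<otimes> v \<oplus> u \<otimes> v\<close> over \<open>u \<in> A\<close> and \<open>v \<in> B\<close>, and these are the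
  nim-sums over \<open>S \<times> T\<close> without its maximum, by distributivity. Intervals of a product order are
  products of intervals, and for coprime \<open>m\<close> and \<open>k\<close> the divisors of \<open>m * k\<close> are the product of those
  of \<open>m\<close> and of \<open>k\<close>, so only chains remain; there the nim-sums of \<open>h\<close> over initial segments form
  the Gray code \<open>n \<oplus> \<lfloor>n / 2\<rfloor>\<close>. Associativity of \<open>\<otimes>\<close> plays no role.
\<close>

section \<open>Minimal excludants and nim-sums\<close>

definition is_mex :: "nat set \<Rightarrow> nat \<Rightarrow> bool" where
  "is_mex S k \<longleftrightarrow> k \<notin> S \<and> {..<k} \<subseteq> S"

lemma is_mex_imp_mex_eq: "is_mex S k \<Longrightarrow> mex S = k"
  unfolding mex_def is_mex_def by (intro Least_equality) (auto simp: not_le[symmetric])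

lemma is_mex_unique: "is_mex S k \<Longrightarrow> is_mex S l \<Longrightarrow> k = l"
  using is_mex_imp_mex_eq by blast

lemma is_mex_mex:
  assumes "finite S"
  shows "is_mex S (mex S)"
proof -
  obtain k where "k \<notin> S"
    using assms infinite_UNIV_nat ex_new_if_finite by blast
  then have "mex S \<notin> S"
    unfolding mex_def by (rule LeastI)
  then show ?thesis
    unfolding is_mex_def mex_def using not_less_Least by blast
qed

lemma is_mex_lessThan: "is_mex {..<a} a"
  by (auto simp: is_mex_def)

lemma xor_left_self [simp]: "a \<oplus> (a \<oplus> b) = (b::nat)"
  by (simp flip: xor.assoc)

lemmas xor_ac = xor.assoc xor.commute xor.left_commute

lemma xor_eq_iff: "a \<oplus> b = c \<longleftrightarrow> a = b \<oplus> (c::nat)"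
  by (metis xor.commute xor_left_self)

lemma xor_left_cancel: "a \<oplus> b = a \<oplus> c \<longleftrightarrow> b = (c::nat)"
  by (metis xor_left_self)

lemma xor_right_cancel: "b \<oplus> a = c \<oplus> a \<longleftrightarrow> b = (c::nat)"
  by (metis xor.commute xor_left_self)

lemma xor_div_power_2: "(a \<oplus> b) div 2 ^ k = a div 2 ^ k \<oplus> b div (2::nat) ^ k"
  by (simp flip: drop_bit_eq_div)

lemmas xor_div_2 = xor_div_power_2[where k = 1, simplified]

lemma less_iff_div_2_less_or_parity:
  "a < b \<longleftrightarrow> a div 2 < b div 2 \<or> a div 2 = b div 2 \<and> even a \<and> odd (b::nat)"
  by presburger

lemma less_xor_cases:
  fixes x y z :: nat
  assumes "z < x \<oplus> y"
  shows "z \<oplus> y < x \<or> x \<oplus> z < y"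
  using assms
proof (induction "x + y" arbitrary: x y z rule: less_induct)
  case less
  have "x + y \<noteq> 0"
    using less.prems by auto
  then have smaller: "x div 2 + y div 2 < x + y"
    by linarith
  consider (half_less) "z div 2 < (x \<oplus> y) div 2"
    | (half_eq) "z div 2 = (x \<oplus> y) div 2" "even z" "odd (x \<oplus> y)"
    using less.prems less_iff_div_2_less_or_parity by blast
  then show ?case
  proof cases
    case half_less
    then have "(z \<oplus> y) div 2 < x div 2 \<or> (x \<oplus> z) div 2 < y div 2"
      using less.hyps[OF smaller] by (simp add: xor_div_2)
    then show ?thesis
      using less_iff_div_2_less_or_parity by blast
  next
    case half_eq
    then have "(z \<oplus> y) div 2 = x div 2" "(x \<oplus> z) div 2 = y div 2"
      by (simp_all add: xor_div_2 xor_ac)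
    moreover have "even (z \<oplus> y) \<and> odd x \<or> even (x \<oplus> z) \<and> odd y"
      using half_eq by (auto simp: even_xor_iff)
    ultimately show ?thesis
      using less_iff_div_2_less_or_parity by blast
  qed
qed

lemma is_mex_xor:
  assumes "is_mex U a" "is_mex V b"
  shows "is_mex ((\<lambda>u. u \<oplus> b) ` U \<union> (\<lambda>v. a \<oplus> v) ` V) (a \<oplus> b)"
  unfolding is_mex_def
proof (intro conjI subsetI)
  show "a \<oplus> b \<notin> (\<lambda>u. u \<oplus> b) ` U \<union> (\<lambda>v. a \<oplus> v) ` V"
    using assms by (auto simp: is_mex_def xor_left_cancel xor_right_cancel)
next
  fix z assume "z \<in> {..<a \<oplus> b}"
  then have "z \<oplus> b < a \<or> a \<oplus> z < b"
    by (intro less_xor_cases) auto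
  then have "z \<oplus> b \<in> U \<or> a \<oplus> z \<in> V"
    using assms unfolding is_mex_def by auto
  moreover have "z = (z \<oplus> b) \<oplus> b" "z = a \<oplus> (a \<oplus> z)"
    by (simp_all add: xor_ac)
  ultimately show "z \<in> (\<lambda>u. u \<oplus> b) ` U \<union> (\<lambda>v. a \<oplus> v) ` V"
    by blast
qed

global_interpretation nim_Sum: comm_monoid_set "Bit_Operations.xor" "0 :: nat"
  defines nim_Sum = nim_Sum.F
  by unfold_locales (auto simp: xor_ac)

lemma nim_Sum_sym_diff:
  assumes "finite A" "finite B"
  shows "nim_Sum f (sym_diff A B) = nim_Sum f A \<oplus> nim_Sum f B"
proof -
  have "nim_Sum f (sym_diff A B) = nim_Sum f (A - B) \<oplus> nim_Sum f (B - A)"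
    using assms by (intro nim_Sum.union_disjoint) auto
  also have "\<dots> = nim_Sum f A \<oplus> nim_Sum f B"
    using nim_Sum.Int_Diff[OF assms(1), of f B] nim_Sum.Int_Diff[OF assms(2), of f A]
    by (simp add: Int_commute xor_ac)
  finally show ?thesis .
qed

lemma nim_Sum_remove:
  assumes "finite A" "a \<in> A"
  shows "nim_Sum f (A - {a}) = nim_Sum f A \<oplus> f a"
  using nim_Sum.remove[OF assms, of f] by (simp add: xor_ac)

lemma is_mex_nim_Sum:
  assumes "finite A" "\<And>a. a \<in> A \<Longrightarrow> is_mex (U a) (f a)"
  shows "is_mex (\<Union>a\<in>A. (\<lambda>u. nim_Sum f (A - {a}) \<oplus> u) ` U a) (nim_Sum f A)"
  using assms
proof (induction A rule: finite_induct)
  case empty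
  then show ?case
    by (simp add: is_mex_def)
next
  case (insert b A)
  let ?U = "\<Union>a\<in>A. (\<lambda>u. nim_Sum f (A - {a}) \<oplus> u) ` U a"
  have "(\<lambda>u. f b \<oplus> nim_Sum f (A - {a}) \<oplus> u) ` U a =
      (\<lambda>u. nim_Sum f (insert b A - {a}) \<oplus> u) ` U a" if "a \<in> A" for a
  proof -
    have "insert b A - {a} = insert b (A - {a})"
      using that insert.hyps by auto
    then show ?thesis
      using insert.hyps by simp
  qed
  then have "(\<Union>a\<in>insert b A. (\<lambda>u. nim_Sum f (insert b A - {a}) \<oplus> u) ` U a) =
      (\<lambda>u. u \<oplus> nim_Sum f A) ` U b \<union> (\<lambda>v. f b \<oplus> v) ` ?U"
    using insert.hyps by (simp add: image_UN image_image xor_ac)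
  moreover have "is_mex ((\<lambda>u. u \<oplus> nim_Sum f A) ` U b \<union> (\<lambda>v. f b \<oplus> v) ` ?U) (f b \<oplus> nim_Sum f A)"
    using insert by (intro is_mex_xor) auto
  ultimately show ?case
    using insert.hyps by simp
qed

section \<open>Nim multiplication\<close>

definition nim_excludent :: "nat \<Rightarrow> nat \<Rightarrow> nat \<times> nat \<Rightarrow> nat" where
  "nim_excludent a b = (\<lambda>(u, v). u \<otimes> b \<oplus> a \<otimes> v \<oplus> u \<otimes> v)"

lemma is_mex_nim_mult_lessThan: "is_mex (nim_excludent a b ` ({..<a} \<times> {..<b})) (a \<otimes> b)"
  unfolding nim_excludent_def
  by (subst (4) nim_mult.simps) (intro is_mex_mex finite_imageI finite_cartesian_product finite_lessThan)

lemma nim_excludent_neq_if_less: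
  assumes "u < a" "v < b"
  shows "nim_excludent a b (u, v) \<noteq> a \<otimes> b"
  using is_mex_nim_mult_lessThan[of a b] assms unfolding is_mex_def by force

text \<open>The claim says that the nim-sum of \<open>\<otimes>\<close> over the four corners of a rectangle does not vanish,
  so only the order of the coordinates in each factor matters.\<close>

lemma nim_excludent_neq:
  assumes "u \<noteq> a" "v \<noteq> b"
  shows "nim_excludent a b (u, v) \<noteq> a \<otimes> b"
proof -
  consider "u < a" "v < b" | "u < a" "b < v" | "a < u" "v < b" | "a < u" "b < v"
    using assms by linarith
  then show ?thesis
    using nim_excludent_neq_if_less[of u a v b] nim_excludent_neq_if_less[of u a b v]
      nim_excludent_neq_if_less[of a u v b] nim_excludent_neq_if_less[of a u b v]
    by cases (auto simp: nim_excludent_def xor_eq_iff xor_ac)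
qed

lemma is_mex_nim_mult:
  assumes "is_mex A a" "is_mex B b"
  shows "is_mex (nim_excludent a b ` (A \<times> B)) (a \<otimes> b)"
  unfolding is_mex_def
proof
  have "nim_excludent a b (u, v) \<noteq> a \<otimes> b" if "u \<in> A" "v \<in> B" for u v
    using assms that by (intro nim_excludent_neq) (auto simp: is_mex_def)
  then show "a \<otimes> b \<notin> nim_excludent a b ` (A \<times> B)"
    by fastforce
  have "{..<a} \<times> {..<b} \<subseteq> A \<times> B"
    using assms by (auto simp: is_mex_def)
  then show "{..<a \<otimes> b} \<subseteq> nim_excludent a b ` (A \<times> B)"
    using is_mex_nim_mult_lessThan[of a b] unfolding is_mex_def by blast
qed

lemma nim_mult_commute: "a \<otimes> b = b \<otimes> a"
proof (induction "a + b" arbitrary: a b rule: less_induct)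
  case less
  have "nim_excludent a b (u, v) = nim_excludent b a (v, u)" if "u < a" "v < b" for u v
    using that less[of u b] less[of a v] less[of u v] by (simp add: nim_excludent_def xor_ac)
  then have "nim_excludent a b ` ({..<a} \<times> {..<b}) = nim_excludent b a ` ({..<b} \<times> {..<a})"
    by (force simp: image_iff)
  then have "is_mex (nim_excludent b a ` ({..<b} \<times> {..<a})) (a \<otimes> b)"
    using is_mex_nim_mult_lessThan[of a b] by (simp only:)
  then show ?case
    using is_mex_nim_mult_lessThan by (rule is_mex_unique)
qed

lemma nim_mult_distrib_right: "(a \<oplus> b) \<otimes> c = a \<otimes> c \<oplus> b \<otimes> c"
proof (induction "a + b + c" arbitrary: a b c rule: less_induct)
  case less
  let ?A = "(\<lambda>u. u \<oplus> b) ` {..<a}" and ?B = "(\<lambda>u. a \<oplus> u) ` {..<b}"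
  have "nim_excludent (a \<oplus> b) c (u \<oplus> b, v) = nim_excludent a c (u, v) \<oplus> b \<otimes> c"
    if "u < a" "v < c" for u v
    using that less[of u b c] less[of a b v] less[of u b v]
    by (simp add: nim_excludent_def xor_ac)
  then have left: "nim_excludent (a \<oplus> b) c ` (?A \<times> {..<c}) =
      (\<lambda>z. z \<oplus> b \<otimes> c) ` nim_excludent a c ` ({..<a} \<times> {..<c})"
    by (force simp: image_iff)
  have "nim_excludent (a \<oplus> b) c (a \<oplus> u, v) = a \<otimes> c \<oplus> nim_excludent b c (u, v)"
    if "u < b" "v < c" for u v
    using that less[of a u c] less[of a b v] less[of a u v]
    by (simp add: nim_excludent_def xor_ac)
  then have right: "nim_excludent (a \<oplus> b) c ` (?B \<times> {..<c}) =
      (\<lambda>z. a \<otimes> c \<oplus> z) ` nim_excludent b c ` ({..<b} \<times> {..<c})"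
    by (force simp: image_iff)
  have "is_mex (nim_excludent (a \<oplus> b) c ` ((?A \<union> ?B) \<times> {..<c})) ((a \<oplus> b) \<otimes> c)"
    by (intro is_mex_nim_mult is_mex_xor is_mex_lessThan)
  moreover have "is_mex (nim_excludent (a \<oplus> b) c ` ((?A \<union> ?B) \<times> {..<c})) (a \<otimes> c \<oplus> b \<otimes> c)"
    unfolding Sigma_Un_distrib1 image_Un left right
    by (intro is_mex_xor is_mex_nim_mult_lessThan)
  ultimately show ?case
    by (rule is_mex_unique)
qed

lemma nim_mult_distrib_left: "c \<otimes> (a \<oplus> b) = c \<otimes> a \<oplus> c \<otimes> b"
  using nim_mult_distrib_right[of a b c] by (simp add: nim_mult_commute)

lemma zero_nim_mult [simp]: "0 \<otimes> a = 0" "a \<otimes> 0 = 0"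
  using nim_mult_distrib_right[of 0 0 a] nim_mult_distrib_left[of a 0 0] by simp_all

lemma nim_excludent_xor: "nim_excludent a b (s \<oplus> a, t \<oplus> b) = s \<otimes> t \<oplus> a \<otimes> b"
  by (simp add: nim_excludent_def nim_mult_distrib_left nim_mult_distrib_right xor_ac)

lemma nim_Sum_nim_mult_distrib_right: "nim_Sum f A \<otimes> c = nim_Sum (\<lambda>a. f a \<otimes> c) A"
  by (induction A rule: infinite_finite_induct) (simp_all add: nim_mult_distrib_right)

lemma nim_Sum_nim_mult_distrib_left: "c \<otimes> nim_Sum f A = nim_Sum (\<lambda>a. c \<otimes> f a) A"
  by (induction A rule: infinite_finite_induct) (simp_all add: nim_mult_distrib_left)

lemma nim_Sum_product:
  "nim_Sum f A \<otimes> nim_Sum g B = nim_Sum (\<lambda>(a, b). f a \<otimes> g b) (A \<times> B)"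
proof -
  have "nim_Sum f A \<otimes> nim_Sum g B = nim_Sum (\<lambda>a. nim_Sum (\<lambda>b. f a \<otimes> g b) B) A"
    by (subst nim_Sum_nim_mult_distrib_right) (simp only: nim_Sum_nim_mult_distrib_left)
  then show ?thesis
    by (simp only: nim_Sum.cartesian_product)
qed

section \<open>Grundy values of coin-turning games\<close>

definition satisfies_mex_rule ::
    "'a set \<Rightarrow> ('a \<Rightarrow> 'a \<Rightarrow> bool) \<Rightarrow> 'a set set \<Rightarrow> ('a \<Rightarrow> nat) \<Rightarrow> bool" where
  "satisfies_mex_rule X le \<T> G \<longleftrightarrow>
     (\<forall>m\<in>X. is_mex ((\<lambda>T. nim_Sum G (T - {m})) ` {T \<in> \<T>. is_maximum le T m}) (G m))"

context coin_turning_game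
begin

lemma turning_set_subset: "T \<in> \<T> \<Longrightarrow> T \<subseteq> X"
  using turning_sets by blast

lemma finite_position: "H \<subseteq> X \<Longrightarrow> finite H"
  using finite_carrier by (rule rev_finite_subset)

lemma coin_moves_eq_UN:
  assumes "H \<subseteq> X"
  shows "coin_moves X le \<T> H = (\<Union>m\<in>H. sym_diff H ` {T \<in> \<T>. is_maximum le T m})"
  using assms unfolding coin_moves_def by blast

lemma grundy_eq_nim_Sum:
  assumes G: "satisfies_mex_rule X le \<T> G" and "H \<subseteq> X"
  shows "grundy (coin_moves X le \<T>) H = nim_Sum G H"
  using wf_coin_moves \<open>H \<subseteq> X\<close>
proof (induction H rule: wf_induct_rule)
  case (less H)
  let ?g = "grundy (coin_moves X le \<T>)"
  let ?turns = "\<lambda>m. {T \<in> \<T>. is_maximum le T m}"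
  have "?g (sym_diff H T) = nim_Sum G (H - {m}) \<oplus> nim_Sum G (T - {m})"
    if "m \<in> H" "T \<in> ?turns m" for m T
  proof -
    have "T \<subseteq> X" "m \<in> T"
      using that turning_set_subset by (auto simp: is_maximum_def)
    have "sym_diff H T \<in> coin_moves X le \<T> H"
      using that coin_moves_eq_UN[OF less.prems] by blast
    then have "?g (sym_diff H T) = nim_Sum G (sym_diff H T)"
      using \<open>T \<subseteq> X\<close> less.prems by (intro less.IH) auto
    also have "\<dots> = nim_Sum G (sym_diff (H - {m}) (T - {m}))"
      using \<open>m \<in> H\<close> \<open>m \<in> T\<close> by (intro arg_cong[where f = "nim_Sum G"]) blast
    also have "\<dots> = nim_Sum G (H - {m}) \<oplus> nim_Sum G (T - {m})"
      using \<open>T \<subseteq> X\<close> less.prems finite_position by (intro nim_Sum_sym_diff finite_Diff) auto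
    finally show ?thesis .
  qed
  then have "?g ` coin_moves X le \<T> H =
      (\<Union>m\<in>H. (\<lambda>u. nim_Sum G (H - {m}) \<oplus> u) ` (\<lambda>T. nim_Sum G (T - {m})) ` ?turns m)"
    unfolding coin_moves_eq_UN[OF less.prems] image_UN image_image
    by (intro SUP_cong image_cong HOL.refl)
  moreover have "is_mex \<dots> (nim_Sum G H)"
    using G less.prems finite_position
    by (intro is_mex_nim_Sum) (auto simp: satisfies_mex_rule_def)
  ultimately show ?case
    using grundy_coin_moves[of H] is_mex_imp_mex_eq by metis
qed

lemma coin_grundy_eqI:
  assumes "satisfies_mex_rule X le \<T> G" "x \<in> X"
  shows "coin_grundy X le \<T> x = G x"
  using grundy_eq_nim_Sum[of G "{x}"] assms by (simp add: coin_grundy_def)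

lemma satisfies_mex_rule_cong:
  assumes "\<And>x. x \<in> X \<Longrightarrow> F x = G x"
  shows "satisfies_mex_rule X le \<T> F \<longleftrightarrow> satisfies_mex_rule X le \<T> G"
proof -
  have "nim_Sum F (T - {m}) = nim_Sum G (T - {m})" if "T \<in> \<T>" for T m
    using assms turning_set_subset[OF that] by (intro nim_Sum.cong) auto
  then have "(\<lambda>T. nim_Sum F (T - {m})) ` {T \<in> \<T>. is_maximum le T m} =
      (\<lambda>T. nim_Sum G (T - {m})) ` {T \<in> \<T>. is_maximum le T m}" for m
    by (intro image_cong) auto
  then show ?thesis
    using assms by (simp add: satisfies_mex_rule_def)
qed

lemma wf_below_maximum: "wf {(t, m). \<exists>T\<in>\<T>. is_maximum le T m \<and> t \<in> T - {m}}"
proof (rule wf_subset[OF wf_measure])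
  have "card {y \<in> X. le y t} < card {y \<in> X. le y m}"
    if "t \<in> X" "m \<in> X" "le t m" "t \<noteq> m" for t m
  proof (rule psubset_card_mono)
    show "{y \<in> X. le y t} \<subset> {y \<in> X. le y m}"
      using that refl antisym trans
      unfolding reflp_on_def antisymp_on_def transp_on_def by blast
  qed (use finite_carrier in simp)
  then show "{(t, m). \<exists>T\<in>\<T>. is_maximum le T m \<and> t \<in> T - {m}} \<subseteq>
      measure (\<lambda>x. card {y \<in> X. le y x})"
    using turning_set_subset by (fastforce simp: is_maximum_def)
qed

lemma ex_satisfies_mex_rule: "\<exists>G. satisfies_mex_rule X le \<T> G"
proof -
  let ?below = "{(t, m). \<exists>T\<in>\<T>. is_maximum le T m \<and> t \<in> T - {m}}"
  let ?values = "\<lambda>g m. (\<lambda>T. nim_Sum g (T - {m})) ` {T \<in> \<T>. is_maximum le T m}"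
  define G where "G = wfrec ?below (\<lambda>g m. mex (?values g m))"
  have "finite \<T>"
    using finite_carrier turning_set_subset by (intro finite_subset[of \<T> "Pow X"]) auto
  have "is_mex (?values G m) (G m)" for m
  proof -
    have "G m = mex (?values (cut G ?below m) m)"
      unfolding G_def by (rule wfrec[OF wf_below_maximum])
    also have "?values (cut G ?below m) m = ?values G m"
      by (intro image_cong HOL.refl nim_Sum.cong cut_apply) blast
    finally show ?thesis
      using is_mex_mex[of "?values G m"] \<open>finite \<T>\<close> by simp
  qed
  then show ?thesis
    unfolding satisfies_mex_rule_def by blast
qed

theorem satisfies_mex_rule_coin_grundy: "satisfies_mex_rule X le \<T> (coin_grundy X le \<T>)"
  using ex_satisfies_mex_rule coin_grundy_eqI satisfies_mex_rule_cong by metis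

end

subsection \<open>Order embeddings\<close>

locale coin_turning_embedding = coin_turning_game X le \<T>
  for X :: "'a set" and le :: "'a \<Rightarrow> 'a \<Rightarrow> bool" and \<T> +
  fixes le' :: "'b \<Rightarrow> 'b \<Rightarrow> bool" and f :: "'a \<Rightarrow> 'b"
  assumes embedding: "\<And>a b. a \<in> X \<Longrightarrow> b \<in> X \<Longrightarrow> le' (f a) (f b) \<longleftrightarrow> le a b"
begin

lemma inj_on_embedding: "inj_on f X"
proof (rule inj_onI)
  fix a b assume "a \<in> X" "b \<in> X" "f a = f b"
  then have "le a b" "le b a"
    using embedding[of a b] embedding[of b a] embedding[of a a] refl by (auto simp: reflp_on_def)
  then show "a = b"
    using antisym \<open>a \<in> X\<close> \<open>b \<in> X\<close> by (auto simp: antisymp_on_def)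
qed

lemma is_maximum_image_iff:
  assumes "T \<in> \<T>" "m \<in> X"
  shows "is_maximum le' (f ` T) (f m) \<longleftrightarrow> is_maximum le T m"
  using assms turning_set_subset[OF assms(1)] embedding inj_on_image_mem_iff[OF inj_on_embedding]
  by (auto simp: is_maximum_def subset_iff)

lemma coin_turning_game_image: "coin_turning_game (f ` X) le' ((`) f ` \<T>)"
proof
  show "reflp_on (f ` X) le'"
    using refl embedding by (simp add: reflp_on_def)
  show "antisymp_on (f ` X) le'"
    using antisym embedding by (auto simp: antisymp_on_def)
  show "transp_on (f ` X) le'"
    by (intro transp_onI) (auto simp: embedding intro: transp_onD[OF trans])
next
  fix T assume "T \<in> (`) f ` \<T>"
  then obtain S where S: "S \<in> \<T>" "T = f ` S"
    by blast
  obtain m where m: "is_maximum le S m"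
    using turning_sets[OF S(1)] by blast
  then have "m \<in> X"
    using turning_set_subset[OF S(1)] by (auto simp: is_maximum_def)
  with S m show "T \<subseteq> f ` X \<and> (\<exists>m. is_maximum le' T m)"
    using S is_maximum_image_iff turning_set_subset by blast
qed (use finite_carrier in simp)

lemma nim_Sum_image_minus:
  assumes "T \<in> \<T>" "m \<in> X"
  shows "nim_Sum G (f ` T - {f m}) = nim_Sum (G \<circ> f) (T - {m})"
proof -
  have "f ` T - {f m} = f ` (T - {m})"
    using inj_on_image_set_diff[OF inj_on_embedding, of T "{m}"] turning_set_subset assms by auto
  moreover have "inj_on f (T - {m})"
    using inj_on_embedding turning_set_subset[OF assms(1)] by (auto intro: inj_on_subset)
  ultimately show ?thesis
    by (simp add: nim_Sum.reindex)
qed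

lemma coin_grundy_image:
  assumes "x \<in> X"
  shows "coin_grundy (f ` X) le' ((`) f ` \<T>) (f x) = coin_grundy X le \<T> x"
proof -
  interpret image: coin_turning_game "f ` X" le' "(`) f ` \<T>"
    by (rule coin_turning_game_image)
  let ?G = "coin_grundy (f ` X) le' ((`) f ` \<T>)"
  have "is_mex ((\<lambda>T. nim_Sum (?G \<circ> f) (T - {m})) ` {T \<in> \<T>. is_maximum le T m}) (?G (f m))"
    if "m \<in> X" for m
  proof -
    have "{T' \<in> (`) f ` \<T>. is_maximum le' T' (f m)} = (`) f ` {T \<in> \<T>. is_maximum le T m}"
      using is_maximum_image_iff that by blast
    then have "(\<lambda>T'. nim_Sum ?G (T' - {f m})) ` {T' \<in> (`) f ` \<T>. is_maximum le' T' (f m)} =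
        (\<lambda>T. nim_Sum (?G \<circ> f) (T - {m})) ` {T \<in> \<T>. is_maximum le T m}"
      using nim_Sum_image_minus that by (simp add: image_image)
    moreover have "is_mex ((\<lambda>T'. nim_Sum ?G (T' - {f m})) `
        {T' \<in> (`) f ` \<T>. is_maximum le' T' (f m)}) (?G (f m))"
      using image.satisfies_mex_rule_coin_grundy that by (simp add: satisfies_mex_rule_def)
    ultimately show ?thesis
      by (simp only:)
  qed
  then have "satisfies_mex_rule X le \<T> (?G \<circ> f)"
    by (simp add: satisfies_mex_rule_def)
  then show ?thesis
    using coin_grundy_eqI assms by fastforce
qed

end

subsection \<open>Products\<close>

definition product_turning_sets :: "'a set set \<Rightarrow> 'b set set \<Rightarrow> ('a \<times> 'b) set set" where
  "product_turning_sets \<S> \<T> = (\<lambda>(S, T). S \<times> T) ` (\<S> \<times> \<T>)"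

lemma is_maximum_Times_iff:
  "is_maximum (rel_prod le le') (S \<times> T) (m, k) \<longleftrightarrow> is_maximum le S m \<and> is_maximum le' T k"
  by (auto simp: is_maximum_def)

lemma product_turning_sets_max:
  "{P \<in> product_turning_sets \<S> \<T>. is_maximum (rel_prod le le') P (m, k)} =
    (\<lambda>(S, T). S \<times> T) ` ({S \<in> \<S>. is_maximum le S m} \<times> {T \<in> \<T>. is_maximum le' T k})"
  unfolding product_turning_sets_def by (auto simp: is_maximum_Times_iff)

locale coin_turning_game_pair =
  left: coin_turning_game X le \<S> + right: coin_turning_game Y le' \<T>
  for X :: "'a set" and le \<S> and Y :: "'b set" and le' \<T>
begin

sublocale product: coin_turning_game "X \<times> Y" "rel_prod le le'" "product_turning_sets \<S> \<T>"
proof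
  show "finite (X \<times> Y)"
    using left.finite_carrier right.finite_carrier by simp
  show "reflp_on (X \<times> Y) (rel_prod le le')"
    using left.refl right.refl by (auto simp: reflp_on_def)
  show "antisymp_on (X \<times> Y) (rel_prod le le')"
    using left.antisym right.antisym by (auto simp: antisymp_on_def)
  show "transp_on (X \<times> Y) (rel_prod le le')"
    by (intro transp_onI) (auto intro: transp_onD[OF left.trans] transp_onD[OF right.trans])
next
  fix P assume "P \<in> product_turning_sets \<S> \<T>"
  then obtain S T where "S \<in> \<S>" "T \<in> \<T>" "P = S \<times> T"
    by (auto simp: product_turning_sets_def)
  then show "P \<subseteq> X \<times> Y \<and> (\<exists>m. is_maximum (rel_prod le le') P m)"
    using left.turning_sets[of S] right.turning_sets[of T] is_maximum_Times_iff by fast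
qed

lemma nim_Sum_Times_minus_maximum:
  assumes "S \<in> \<S>" "is_maximum le S m" "T \<in> \<T>" "is_maximum le' T k"
  shows "nim_Sum (\<lambda>(x, y). F x \<otimes> G y) (S \<times> T - {(m, k)}) =
    nim_excludent (F m) (G k) (nim_Sum F (S - {m}), nim_Sum G (T - {k}))"
proof -
  have "finite S" "m \<in> S" "finite T" "k \<in> T"
    using assms left.turning_set_subset left.finite_position right.turning_set_subset
      right.finite_position by (auto simp: is_maximum_def)
  then show ?thesis
    by (simp add: nim_Sum_remove nim_excludent_xor nim_Sum_product)
qed

theorem tartan:
  assumes "x \<in> X" "y \<in> Y"
  shows "coin_grundy (X \<times> Y) (rel_prod le le') (product_turning_sets \<S> \<T>) (x, y) =
    coin_grundy X le \<S> x \<otimes> coin_grundy Y le' \<T> y"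
proof -
  let ?F = "coin_grundy X le \<S>" and ?G = "coin_grundy Y le' \<T>"
  let ?FG = "\<lambda>(x, y). ?F x \<otimes> ?G y"
  have "is_mex ((\<lambda>P. nim_Sum ?FG (P - {(m, k)})) `
      {P \<in> product_turning_sets \<S> \<T>. is_maximum (rel_prod le le') P (m, k)}) (?F m \<otimes> ?G k)"
    if "m \<in> X" "k \<in> Y" for m k
  proof -
    let ?A = "(\<lambda>S. nim_Sum ?F (S - {m})) ` {S \<in> \<S>. is_maximum le S m}"
    let ?B = "(\<lambda>T. nim_Sum ?G (T - {k})) ` {T \<in> \<T>. is_maximum le' T k}"
    have "(\<lambda>P. nim_Sum ?FG (P - {(m, k)})) `
        {P \<in> product_turning_sets \<S> \<T>. is_maximum (rel_prod le le') P (m, k)} =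
      (\<lambda>(S, T). nim_excludent (?F m) (?G k) (nim_Sum ?F (S - {m}), nim_Sum ?G (T - {k}))) `
        ({S \<in> \<S>. is_maximum le S m} \<times> {T \<in> \<T>. is_maximum le' T k})"
      unfolding product_turning_sets_max image_image
      using nim_Sum_Times_minus_maximum by (intro image_cong) auto
    also have "\<dots> = nim_excludent (?F m) (?G k) ` (?A \<times> ?B)"
      by (force simp: image_iff)
    finally show ?thesis
      using is_mex_nim_mult[of ?A "?F m" ?B "?G k"] that left.satisfies_mex_rule_coin_grundy
        right.satisfies_mex_rule_coin_grundy by (simp add: satisfies_mex_rule_def)
  qed
  then have "satisfies_mex_rule (X \<times> Y) (rel_prod le le') (product_turning_sets \<S> \<T>) ?FG"
    by (auto simp: satisfies_mex_rule_def)
  then show ?thesis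
    using product.coin_grundy_eqI assms by fastforce
qed

end

section \<open>Rulers\<close>

lemma closed_intervals_Times:
  "closed_intervals (X \<times> Y) (rel_prod le le') =
    product_turning_sets (closed_intervals X le) (closed_intervals Y le')"
proof -
  let ?I = "\<lambda>a b. {t \<in> X. le a t \<and> le t b}" and ?J = "\<lambda>c d. {t \<in> Y. le' c t \<and> le' t d}"
  have "{t \<in> X \<times> Y. rel_prod le le' (a, c) t \<and> rel_prod le le' t (b, d)} = ?I a b \<times> ?J c d"
    for a b c d
    by auto
  then have "closed_intervals (X \<times> Y) (rel_prod le le') =
      {?I a b \<times> ?J c d | a b c d. a \<in> X \<and> b \<in> X \<and> le a b \<and> c \<in> Y \<and> d \<in> Y \<and> le' c d}"
    unfolding closed_intervals_def by fastforce
  also have "\<dots> = product_turning_sets (closed_intervals X le) (closed_intervals Y le')"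
    unfolding closed_intervals_def product_turning_sets_def by blast
  finally show ?thesis .
qed

lemma closed_intervals_image:
  assumes "\<And>a b. a \<in> X \<Longrightarrow> b \<in> X \<Longrightarrow> le' (f a) (f b) \<longleftrightarrow> le a b"
  shows "closed_intervals (f ` X) le' = (`) f ` closed_intervals X le"
proof -
  have "{t \<in> f ` X. le' (f a) t \<and> le' t (f b)} = f ` {t \<in> X. le a t \<and> le t b}"
    if "a \<in> X" "b \<in> X" for a b
    using that assms by auto
  then have "{f ` {t \<in> X. le a t \<and> le t b} | a b. a \<in> X \<and> b \<in> X \<and> le a b} =
      {{t \<in> f ` X. le' (f a) t \<and> le' t (f b)} | a b. a \<in> X \<and> b \<in> X \<and> le' (f a) (f b)}"
    using assms by (intro Collect_cong ex_cong1) auto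
  also have "\<dots> = closed_intervals (f ` X) le'"
    unfolding closed_intervals_def by blast
  also have "{f ` {t \<in> X. le a t \<and> le t b} | a b. a \<in> X \<and> b \<in> X \<and> le a b} =
      (`) f ` closed_intervals X le"
    unfolding closed_intervals_def by blast
  finally show ?thesis ..
qed

text \<open>The hypothesis that the ruler is a coin-turning game says exactly that the carrier is a finite
  poset.\<close>

lemma ruler_grundy_Times:
  assumes "coin_turning_game X le (closed_intervals X le)"
    and "coin_turning_game Y le' (closed_intervals Y le')"
    and "x \<in> X" "y \<in> Y"
  shows "ruler_grundy (X \<times> Y) (rel_prod le le') (x, y) = ruler_grundy X le x \<otimes> ruler_grundy Y le' y"
proof -
  interpret coin_turning_game_pair X le "closed_intervals X le" Y le' "closed_intervals Y le'"
    using assms by (simp add: coin_turning_game_pair_def)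
  show ?thesis
    using tartan assms by (simp add: ruler_grundy_def closed_intervals_Times)
qed

lemma ruler_grundy_image:
  assumes "coin_turning_game X le (closed_intervals X le)"
    and "\<And>a b. a \<in> X \<Longrightarrow> b \<in> X \<Longrightarrow> le' (f a) (f b) \<longleftrightarrow> le a b"
    and "x \<in> X"
  shows "ruler_grundy (f ` X) le' (f x) = ruler_grundy X le x"
proof -
  interpret coin_turning_embedding X le "closed_intervals X le" le' f
    using assms by (simp add: coin_turning_embedding_def coin_turning_embedding_axioms_def)
  show ?thesis
    using coin_grundy_image assms(2,3)
    by (simp add: ruler_grundy_def closed_intervals_image[where le = le])
qed

subsection \<open>Chains\<close>

definition gray :: "nat \<Rightarrow> nat" where
  "gray n = n \<oplus> n div 2"

lemma gray_div_power_2: "gray n div 2 ^ k = gray (n div 2 ^ k)"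
  by (simp add: gray_def xor_div_power_2 mult.commute flip: div_mult2_eq)

lemmas gray_div_2 = gray_div_power_2[where k = 1, simplified]

lemma even_gray_iff: "even (gray n) \<longleftrightarrow> (even n \<longleftrightarrow> even (n div 2))"
  by (simp add: gray_def even_xor_iff)

lemma gray_xor: "gray (m \<oplus> n) = gray m \<oplus> gray n"
  by (simp add: gray_def xor_div_2 xor_ac)

lemma inj_gray: "inj gray"
proof (rule injI)
  fix m n assume "gray m = gray n"
  then have "m \<oplus> n = (m \<oplus> n) div 2"
    using gray_xor[of m n] xor_eq_iff[of "m \<oplus> n" "(m \<oplus> n) div 2" 0] by (simp add: gray_def)
  then have "m \<oplus> n = 0"
    by linarith
  then show "m = n"
    by (simp add: xor_eq_iff)
qed

lemma h_odd: "odd n \<Longrightarrow> h n = 1"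
  by (simp add: h_def not_dvd_imp_multiplicity_0)

lemma h_double: "n > 0 \<Longrightarrow> h (2 * n) = 2 * h n"
  by (simp add: h_def multiplicity_times_same)

lemma gray_xor_gray_Suc: "gray n \<oplus> gray (Suc n) = h (Suc n)"
proof (induction n rule: less_induct)
  case (less n)
  have half: "(gray n \<oplus> gray (Suc n)) div 2 = gray (n div 2) \<oplus> gray (Suc n div 2)"
    by (simp add: xor_div_2 gray_div_2)
  show ?case
  proof (cases "even n")
    case True
    then have "(gray n \<oplus> gray (Suc n)) div 2 = 0" "odd (gray n \<oplus> gray (Suc n))"
      using half by (simp_all add: even_xor_iff even_gray_iff)
    then have "gray n \<oplus> gray (Suc n) = 1"
      by presburger
    then show ?thesis
      using True by (simp add: h_odd)
  next
    case False
    then obtain m where m: "n = 2 * m + 1"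
      by (elim oddE)
    then have "(gray n \<oplus> gray (Suc n)) div 2 = h (Suc m)"
      using half less.IH[of m] by simp
    moreover have "even (gray n \<oplus> gray (Suc n))"
      using m by (simp add: even_xor_iff even_gray_iff)
    ultimately have "gray n \<oplus> gray (Suc n) = 2 * h (Suc m)"
      by presburger
    then show ?thesis
      using h_double[of "Suc m"] m by simp
  qed
qed

lemma nim_Sum_h_Suc:
  assumes "a \<le> x"
  shows "nim_Sum (\<lambda>j. h (Suc j)) {a..<x} = gray a \<oplus> gray x"
  using assms
proof (induction x rule: dec_induct)
  case (step x)
  then show ?case
    by (simp add: atLeastLessThanSuc xor_ac flip: gray_xor_gray_Suc)
qed simp

lemma gray_xor_image_block:
  assumes "x div 2 ^ k = q"
  shows "(\<lambda>a. gray a \<oplus> gray x) ` {2 ^ k * q..<2 ^ k * q + 2 ^ k} = {..<2 ^ k}"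
proof (rule card_subset_eq)
  have "(gray a \<oplus> gray x) div 2 ^ k = 0" if "a \<in> {2 ^ k * q..<2 ^ k * q + 2 ^ k}" for a
  proof -
    have "a div 2 ^ k = q"
      using that by (intro div_nat_eqI) (auto simp: algebra_simps)
    then show ?thesis
      using assms by (simp add: xor_div_power_2 gray_div_power_2)
  qed
  then show "(\<lambda>a. gray a \<oplus> gray x) ` {2 ^ k * q..<2 ^ k * q + 2 ^ k} \<subseteq> {..<2 ^ k}"
    by (auto simp: div_eq_0_iff)
  have "inj_on (\<lambda>a. gray a \<oplus> gray x) A" for A
    by (auto intro!: inj_onI simp: xor_right_cancel inj_eq[OF inj_gray])
  then show "card ((\<lambda>a. gray a \<oplus> gray x) ` {2 ^ k * q..<2 ^ k * q + 2 ^ k}) = card {..<(2::nat) ^ k}"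
    by (simp add: card_image)
qed simp

lemma is_mex_gray_xor: "is_mex ((\<lambda>a. gray a \<oplus> gray x) ` {..x}) (h (Suc x))"
  unfolding is_mex_def
proof
  have "gray a \<oplus> gray x \<noteq> h (Suc x)" if "a \<le> x" for a
    using that injD[OF inj_gray, of a "Suc x"] xor_eq_iff[of "gray a" "gray x"]
    by (auto simp flip: gray_xor_gray_Suc)
  then show "h (Suc x) \<notin> (\<lambda>a. gray a \<oplus> gray x) ` {..x}"
    by force
next
  define k where "k = multiplicity 2 (Suc x)"
  have "2 ^ k dvd Suc x"
    unfolding k_def by (rule multiplicity_dvd)
  then obtain q where q: "Suc x = 2 ^ k * Suc q"
    by (metis dvdE mult_is_0 not0_implies_Suc nat.distinct(1))
  then have x: "Suc x = 2 ^ k * q + 2 ^ k"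
    by simp
  moreover have "(2::nat) ^ k > 0"
    by simp
  ultimately have "2 ^ k * q \<le> x"
    by linarith
  then have "x div 2 ^ k = q"
    using q by (intro div_nat_eqI) linarith+
  then have "(\<lambda>a. gray a \<oplus> gray x) ` {2 ^ k * q..<2 ^ k * q + 2 ^ k} = {..<2 ^ k}"
    by (rule gray_xor_image_block)
  moreover have "{2 ^ k * q..<2 ^ k * q + 2 ^ k} \<subseteq> {..x}"
    using x by auto
  ultimately show "{..<h (Suc x)} \<subseteq> (\<lambda>a. gray a \<oplus> gray x) ` {..x}"
    unfolding h_def k_def[symmetric] by blast
qed

lemma coin_turning_game_chain:
  "coin_turning_game {..e::nat} (\<le>) (closed_intervals {..e} (\<le>))"
  by (intro ruler_coin_turning_game) (auto simp: reflp_on_def antisymp_on_def transp_on_def)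

lemma closed_intervals_chain_max:
  assumes "x \<le> e"
  shows "{T \<in> closed_intervals {..e::nat} (\<le>). is_maximum (\<le>) T x} = (\<lambda>a. {a..x}) ` {..x}"
proof -
  have "{t \<in> {..e}. a \<le> t \<and> t \<le> b} = {a..b}" if "b \<le> e" for a b
    using that by auto
  moreover have "is_maximum (\<le>) {a..b} x \<longleftrightarrow> b = x" if "a \<le> b" for a b
    using that by (auto simp: is_maximum_def intro!: order.antisym)
  ultimately show ?thesis
    using assms unfolding closed_intervals_def by (fastforce simp: image_iff)
qed

lemma ruler_grundy_chain:
  assumes "x \<le> e"
  shows "ruler_grundy {..e::nat} (\<le>) x = h (Suc x)"
proof -
  interpret coin_turning_game "{..e}" "(\<le>)" "closed_intervals {..e} (\<le>)"
    by (rule coin_turning_game_chain)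
  have "is_mex ((\<lambda>T. nim_Sum (\<lambda>j. h (Suc j)) (T - {m})) `
      {T \<in> closed_intervals {..e} (\<le>). is_maximum (\<le>) T m}) (h (Suc m))" if "m \<le> e" for m
  proof -
    have "nim_Sum (\<lambda>j. h (Suc j)) ({a..m} - {m}) = gray a \<oplus> gray m" if "a \<le> m" for a
      using nim_Sum_h_Suc[OF that] by (simp add: atLeastLessThan_eq_atLeastAtMost_diff)
    then show ?thesis
      using is_mex_gray_xor[of m]
      by (simp add: closed_intervals_chain_max[OF that] image_image cong: image_cong_simp)
  qed
  then show ?thesis
    unfolding ruler_grundy_def using assms
    by (intro coin_grundy_eqI) (auto simp: satisfies_mex_rule_def)
qed

subsection \<open>Divisors\<close>

lemma divisors_mult_eq_image: "divisors (m * k) = (\<lambda>(d, c). d * c) ` (divisors m \<times> divisors k)"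
proof (intro equalityI subsetI)
  fix t assume "t \<in> divisors (m * k)"
  then obtain d c where "t = d * c" "d dvd m" "c dvd k" "0 < t"
    using division_decomp[of t m k] by (auto simp: divisors_def)
  then show "t \<in> (\<lambda>(d, c). d * c) ` (divisors m \<times> divisors k)"
    by (auto simp: divisors_def)
qed (auto simp: divisors_def mult_dvd_mono)

lemma coprime_mult_dvd_mult_iff:
  fixes m k :: nat
  assumes "coprime m k" "d dvd m" "d' dvd m" "c dvd k" "c' dvd k"
  shows "d * c dvd d' * c' \<longleftrightarrow> d dvd d' \<and> c dvd c'"
proof
  have "coprime d c'" "coprime c d'"
    using assms coprime_divisors coprime_commute by metis+
  moreover assume "d * c dvd d' * c'"
  then have "d dvd d' * c'" "c dvd d' * c'"
    by (auto dest: dvd_mult_left dvd_mult_right)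
  ultimately show "d dvd d' \<and> c dvd c'"
    by (simp add: coprime_dvd_mult_left_iff coprime_dvd_mult_right_iff)
qed (simp add: mult_dvd_mono)

lemma ruler_grundy_divisors_mult:
  assumes "coprime m k" "m > 0" "k > 0" "x dvd m" "y dvd k"
  shows "ruler_grundy (divisors (m * k)) (dvd) (x * y) =
    ruler_grundy (divisors m) (dvd) x \<otimes> ruler_grundy (divisors k) (dvd) y"
proof -
  interpret coin_turning_game_pair
    "divisors m" "(dvd)" "closed_intervals (divisors m) (dvd)"
    "divisors k" "(dvd)" "closed_intervals (divisors k) (dvd)"
    using assms(2,3) by (simp add: coin_turning_game_pair_def divisors_ruler_game)
  have xy: "x \<in> divisors m" "y \<in> divisors k"
    using assms(2-5) by (auto simp: divisors_def intro: dvd_pos_nat)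
  have "ruler_grundy (divisors (m * k)) (dvd) (case (x, y) of (d, c) \<Rightarrow> d * c) =
      ruler_grundy (divisors m \<times> divisors k) (rel_prod (dvd) (dvd)) (x, y)"
    unfolding divisors_mult_eq_image
    using product.coin_turning_game_axioms coprime_mult_dvd_mult_iff[OF assms(1)] xy
    by (intro ruler_grundy_image) (auto simp: closed_intervals_Times divisors_def)
  also have "\<dots> = ruler_grundy (divisors m) (dvd) x \<otimes> ruler_grundy (divisors k) (dvd) y"
    using left.coin_turning_game_axioms right.coin_turning_game_axioms xy
    by (rule ruler_grundy_Times)
  finally show ?thesis
    by simp
qed

lemma divisors_prime_power: "prime q \<Longrightarrow> divisors (q ^ e) = (\<lambda>j. q ^ j) ` {..e}"
  by (auto simp: divisors_def divides_primepow_nat prime_gt_0_nat)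

lemma ruler_grundy_divisors_prime_power:
  assumes "prime q" "x \<le> e"
  shows "ruler_grundy (divisors (q ^ e)) (dvd) (q ^ x) = h (Suc x)"
proof -
  have "ruler_grundy (divisors (q ^ e)) (dvd) (q ^ x) = ruler_grundy {..e} (\<le>) x"
    unfolding divisors_prime_power[OF \<open>prime q\<close>]
    using coin_turning_game_chain dvd_power_iff_le[OF prime_ge_2_nat[OF \<open>prime q\<close>]] assms(2)
    by (intro ruler_grundy_image) auto
  also have "\<dots> = h (Suc x)"
    using assms(2) by (rule ruler_grundy_chain)
  finally show ?thesis .
qed

lemma coprime_prod_prime_powers_Suc:
  assumes "\<forall>i\<in>{1..Suc r}. prime (p i)" "inj_on p {1..Suc r}"
  shows "coprime (\<Prod>i=1..r. p i ^ e i) (p (Suc r) ^ k :: nat)"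
proof (rule prod_coprime_left)
  fix i assume "i \<in> {1..r}"
  then have "p i \<noteq> p (Suc r)"
    using inj_onD[OF assms(2), of i "Suc r"] by auto
  then show "coprime (p i ^ e i) (p (Suc r) ^ k)"
    using assms(1) \<open>i \<in> {1..r}\<close> by (simp add: primes_coprime)
qed

theorem mainTheorem2:
  fixes r n y :: nat and p e x :: "nat \<Rightarrow> nat"
  assumes "\<forall>i\<in>{1..r}. prime (p i)"
    and "inj_on p {1..r}"
    and "\<forall>i\<in>{1..r}. e i > 0"
    and "n = (\<Prod>i=1..r. p i ^ e i)"
    and "\<forall>i\<in>{1..r}. x i \<le> e i"
    and "y = (\<Prod>i=1..r. p i ^ x i)"
  shows "ruler_grundy (divisors n) (dvd) y = nim_prod (\<lambda>i. h (x i + 1)) r"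
  using assms
proof (induction r arbitrary: n y)
  case 0
  then show ?case
    using ruler_grundy_divisors_prime_power[of 2 0 0] by (simp add: h_odd)
next
  case (Suc r)
  let ?n = "\<Prod>i=1..r. p i ^ e i" and ?y = "\<Prod>i=1..r. p i ^ x i" and ?q = "p (Suc r)"
  have "prime ?q" "x (Suc r) \<le> e (Suc r)"
    using Suc.prems by auto
  have "?n > 0" "?q ^ e (Suc r) > 0" "?y dvd ?n" "?q ^ x (Suc r) dvd ?q ^ e (Suc r)"
    using Suc.prems
    by (auto simp: prime_gt_0_nat intro!: prod_pos prod_dvd_prod le_imp_power_dvd)
  then have "ruler_grundy (divisors n) (dvd) y = ruler_grundy (divisors ?n) (dvd) ?y \<otimes>
      ruler_grundy (divisors (?q ^ e (Suc r))) (dvd) (?q ^ x (Suc r))"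
    using Suc.prems coprime_prod_prime_powers_Suc[OF Suc.prems(1,2)]
      ruler_grundy_divisors_mult by simp
  also have "ruler_grundy (divisors ?n) (dvd) ?y = nim_prod (\<lambda>i. h (x i + 1)) r"
    using Suc.prems by (intro Suc.IH) (auto intro: inj_on_subset)
  also have "ruler_grundy (divisors (?q ^ e (Suc r))) (dvd) (?q ^ x (Suc r)) = h (x (Suc r) + 1)"
    using ruler_grundy_divisors_prime_power[OF \<open>prime ?q\<close> \<open>x (Suc r) \<le> e (Suc r)\<close>] by simp
  finally show ?case
    by simp
qed

end
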